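(* Assume $M>3$ and let $k\ge0$ be an integer. Set $$a_j=-\Big(M-\frac12\Big),\qquad b_j=M^j,\qquad j=1,\dots,k.$$ Let $W_k:\mathbb{R}\to\mathbb{R}$ be an even potential with $$W_k'(x)=\frac{M}{2M-4}\big(-\operatorname{sgn}(x)+2x\big)+\begin{cases}0,&|x|\le M^{-k},\\ a_j\operatorname{sgn}(x)+b_jx,&(M-2)M^{-j}\le|x|\le M^{1-j},\ j=1,\dots,k,\\ \text{smoothly connected},&\text{otherwise.}\end{cases}$$ Then $\rho_k$ (defined in the context) is a steady state of the interaction energy with interaction potential $W_k$.
   Context: Define closed intervals $I_{k,l}$, $k=0,1,\dots$, $l=0,\dots,2^k-1$, by $I_{0,0}=[0,1]$, $I_{k+1,2l}=I_{k,l}^{\mathrm{left}}$, $I_{k+1,2l+1}=I_{k,l}^{\mathrm{right}}$, where for $I=[x_1,x_2]$, $I^{\mathrm{left}}=[x_1,x_1+\frac{x_2-x_1}{M}]$ and $I^{\mathrm{right}}=[x_2-\frac{x_2-x_1}{M},x_2]$. Let $$\rho_k=\Big(\frac M2\Big)^k\sum_{l=0}^{2^k-1}\chi_{I_{k,l}},$$ a probability density supported on $S_k=\bigcup_lI_{k,l}$. "Smoothly connected" means that on the remaining set the second summand of $W_k'$ is chosen arbitrarily so that it is an odd, continuous, piecewise $C^1$ function on $\mathbb{R}$; the particular choice is immaterial. Steady state: $\rho$ is a steady state of the interaction energy with potential $W$ if $0\in\partial V(x)$ for $\rho$-a.e. $x$, where $V=W*\rho$ and $\partial V$ is its subdifferential;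 when $V\in C^1$ this means $V'=W'*\rho=0$ on $\operatorname{supp}\rho$. *)

theory Defs
  imports "HOL-Analysis.Analysis" "HOL-Probability.Probability"
begin

section \<open>Subdifferential and steady states\<close>

text \<open>Frechet (regular) subdifferential: all \<open>\<xi>\<close> with
  \<open>V y \<ge> V x + \<xi> (y - x) + o(\<bar>y - x\<bar>)\<close> as \<open>y \<rightarrow> x\<close>. The global subdifferential of convex
  analysis would not reduce to the derivative for nonconvex differentiable \<open>V\<close>.\<close>

definition subdifferential :: "(real \<Rightarrow> real) \<Rightarrow> real \<Rightarrow> real set" where
  "subdifferential V x =
     {\<xi>. \<forall>\<epsilon>>0. \<forall>\<^sub>F y in at x. V y - V x - \<xi> * (y - x) \<ge> - \<epsilon> * \<bar>y - x\<bar>}"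

definition potential_field :: "(real \<Rightarrow> real) \<Rightarrow> real measure \<Rightarrow> real \<Rightarrow> real" where
  "potential_field W \<rho> x = (\<integral>y. W (x - y) \<partial>\<rho>)"

text \<open>The integrability clause says that \<open>W * \<rho>\<close> is well defined; otherwise the
  default value \<open>0\<close> of a divergent Bochner integral would enter.\<close>

definition steady_state :: "(real \<Rightarrow> real) \<Rightarrow> real measure \<Rightarrow> bool" where
  "steady_state W \<rho> \<longleftrightarrow>
     (\<forall>x. integrable \<rho> (\<lambda>y. W (x - y))) \<and>
     (AE x in \<rho>. 0 \<in> subdifferential (potential_field W \<rho>) x)"

definition measure_support :: "real measure \<Rightarrow> real set" where
  "measure_support \<rho> = {x. \<forall>U. open U \<longrightarrow> x \<in> U \<longrightarrow> emeasure \<rho> U > 0}"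

lemma subdifferential_differentiable:
  assumes "(V has_real_derivative d) (at x)"
  shows "subdifferential V x = {d}"
proof -
  have lim: "((\<lambda>y. (V y - V x) / (y - x)) \<longlongrightarrow> d) (at x)"
    using assms by (simp add: has_field_derivative_iff)
  have "d \<in> subdifferential V x"
    unfolding subdifferential_def
  proof (intro CollectI allI impI)
    fix e :: real assume "e > 0"
    have "\<forall>\<^sub>F y in at x. \<bar>(V y - V x) / (y - x) - d\<bar> < e"
      using tendstoD[OF lim \<open>e > 0\<close>] by (simp add: dist_real_def)
    moreover have "\<forall>\<^sub>F y in at x. y \<noteq> x"
      by (simp add: eventually_at_filter)
    ultimately show "\<forall>\<^sub>F y in at x. V y - V x - d * (y - x) \<ge> - e * \<bar>y - x\<bar>"
    proof eventually_elim
      case (elim y)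
      have "\<bar>V y - V x - d * (y - x)\<bar> = \<bar>(V y - V x) / (y - x) - d\<bar> * \<bar>y - x\<bar>"
        using elim(2) by (simp add: abs_mult[symmetric] field_simps)
      also have "\<dots> \<le> e * \<bar>y - x\<bar>"
        using elim(1) by (intro mult_right_mono) auto
      finally show ?case by linarith
    qed
  qed
  moreover have "\<xi> = d" if \<xi>: "\<xi> \<in> subdifferential V x" for \<xi>
  proof (rule antisym)
    have ev: "\<forall>\<^sub>F y in at x. V y - V x - \<xi> * (y - x) \<ge> - e * \<bar>y - x\<bar>" if "e > 0" for e
      using \<xi> that by (simp add: subdifferential_def)
    have limr: "((\<lambda>y. (V y - V x) / (y - x)) \<longlongrightarrow> d) (at_right x)"
      and liml: "((\<lambda>y. (V y - V x) / (y - x)) \<longlongrightarrow> d) (at_left x)"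
      using lim filterlim_at_split by blast+
    show "\<xi> \<le> d"
    proof (rule field_le_epsilon)
      fix e :: real assume e: "e > 0"
      have "\<forall>\<^sub>F y in at_right x. V y - V x - \<xi> * (y - x) \<ge> - e * \<bar>y - x\<bar>"
        using ev[OF e] by (simp add: eventually_at_split)
      moreover have "\<forall>\<^sub>F y in at_right x. y > x"
        by (simp add: eventually_at_filter)
      ultimately have "\<forall>\<^sub>F y in at_right x. \<xi> - e \<le> (V y - V x) / (y - x)"
        by eventually_elim (simp add: field_simps)
      from tendsto_lowerbound[OF limr this] show "\<xi> \<le> d + e" by simp
    qed
    show "d \<le> \<xi>"
    proof (rule field_le_epsilon)
      fix e :: real assume e: "e > 0"
      have "\<forall>\<^sub>F y in at_left x. V y - V x - \<xi> * (y - x) \<ge> - e * \<bar>y - x\<bar>"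
        using ev[OF e] by (simp add: eventually_at_split)
      moreover have "\<forall>\<^sub>F y in at_left x. y < x"
        by (simp add: eventually_at_filter)
      ultimately have "\<forall>\<^sub>F y in at_left x. \<xi> + e \<ge> (V y - V x) / (y - x)"
        by eventually_elim (simp add: field_simps)
      from tendsto_upperbound[OF liml this] show "d \<le> \<xi> + e" by simp
    qed
  qed
  ultimately show ?thesis by blast
qed

lemma steady_state_C1_iff:
  assumes int: "\<And>x. integrable \<rho> (\<lambda>y. W (x - y))"
    and sets: "sets \<rho> = sets borel"
    and der: "\<And>x. (potential_field W \<rho> has_real_derivative V' x) (at x)"
    and cont: "continuous_on UNIV V'"
  shows "steady_state W \<rho> \<longleftrightarrow> (\<forall>x \<in> measure_support \<rho>. V' x = 0)"
proof -
  have space: "space \<rho> = UNIV"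
    using sets_eq_imp_space_eq[OF sets] by simp
  have opn: "open {x. V' x \<noteq> 0}"
    using open_Collect_neq[OF cont, of "\<lambda>_. 0"] by simp
  have "steady_state W \<rho> \<longleftrightarrow> (AE x in \<rho>. V' x = 0)"
    by (auto simp: steady_state_def int subdifferential_differentiable[OF der])
  also have "\<dots> \<longleftrightarrow> emeasure \<rho> {x. V' x \<noteq> 0} = 0"
    by (subst AE_iff_measurable[OF _ refl]) (use opn in \<open>auto simp: sets space\<close>)
  also have "\<dots> \<longleftrightarrow> (\<forall>x \<in> measure_support \<rho>. V' x = 0)"
  proof
    assume "emeasure \<rho> {x. V' x \<noteq> 0} = 0"
    with opn show "\<forall>x \<in> measure_support \<rho>. V' x = 0"
      by (force simp: measure_support_def)
  next
    assume *: "\<forall>x \<in> measure_support \<rho>. V' x = 0"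
    define F where "F = {U. open U \<and> emeasure \<rho> U = 0}"
    obtain G where G: "G \<subseteq> F" "countable G" "\<Union>G = \<Union>F"
      using Lindelof[of F] by (auto simp: F_def)
    have "\<Union>G \<in> null_sets \<rho>"
      using G by (intro null_sets_UN'[where N = id, simplified])
        (auto simp: F_def null_sets_def sets)
    moreover have "{x. V' x \<noteq> 0} \<subseteq> \<Union>G"
      using * G(3) by (auto simp: F_def measure_support_def zero_less_iff_neq_zero)
    ultimately show "emeasure \<rho> {x. V' x \<noteq> 0} = 0"
      using opn by (meson emeasure_eq_0 null_setsD1 null_setsD2)
  qed
  finally show ?thesis .
qed


section \<open>The iterated intervals and the density\<close>

text \<open>A closed interval \<open>[x\<^sub>1, x\<^sub>2]\<close> is encoded by the pair of its endpoints.\<close>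

definition left_part :: "real \<Rightarrow> real \<times> real \<Rightarrow> real \<times> real" where
  "left_part M I = (fst I, fst I + (snd I - fst I) / M)"

definition right_part :: "real \<Rightarrow> real \<times> real \<Rightarrow> real \<times> real" where
  "right_part M I = (snd I - (snd I - fst I) / M, snd I)"

fun endpoints :: "real \<Rightarrow> nat \<Rightarrow> nat \<Rightarrow> real \<times> real" where
  "endpoints M 0 l = (0, 1)"
| "endpoints M (Suc k) l =
     (if even l then left_part M (endpoints M k (l div 2))
      else right_part M (endpoints M k (l div 2)))"

definition interval :: "real \<Rightarrow> nat \<Rightarrow> nat \<Rightarrow> real set" where
  "interval M k l = {fst (endpoints M k l) .. snd (endpoints M k l)}"

definition density_fun :: "real \<Rightarrow> nat \<Rightarrow> real \<Rightarrow> real" where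
  "density_fun M k x = (M / 2) ^ k * (\<Sum>l<2 ^ k. indicator (interval M k l) x)"

definition density_measure :: "real \<Rightarrow> nat \<Rightarrow> real measure" where
  "density_measure M k = density lborel (\<lambda>x. ennreal (density_fun M k x))"

lemma endpoints_length: "snd (endpoints M k l) - fst (endpoints M k l) = (1 / M) ^ k"
  by (induction k arbitrary: l) (simp_all add: left_part_def right_part_def)

lemma prob_space_density_measure:
  assumes "M > 0"
  shows "prob_space (density_measure M k)"
proof
  have le: "fst (endpoints M k l) \<le> snd (endpoints M k l)" for l
    using endpoints_length[of M k l] assms by (smt (verit) zero_le_power divide_nonneg_pos)
  have [measurable]: "interval M k l \<in> sets borel" for l
    by (simp add: interval_def)
  have "emeasure (density_measure M k) UNIV = (\<integral>\<^sup>+x. ennreal (density_fun M k x) \<partial>lborel)"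
    unfolding density_measure_def
    by (subst emeasure_density) (auto simp: density_fun_def)
  also have "\<dots> = (\<integral>\<^sup>+x. ennreal ((M / 2) ^ k) * (\<Sum>l<2 ^ k. indicator (interval M k l) x) \<partial>lborel)"
    using assms by (intro nn_integral_cong)
      (simp add: density_fun_def ennreal_mult sum_nonneg ennreal_indicator flip: sum_ennreal)
  also have "\<dots> = ennreal ((M / 2) ^ k) * (\<Sum>l<2 ^ k. emeasure lborel (interval M k l))"
    by (simp add: nn_integral_cmult nn_integral_sum)
  also have "\<dots> = ennreal ((M / 2) ^ k) * (\<Sum>l<(2::nat) ^ k. ennreal ((1 / M) ^ k))"
    using le by (simp add: interval_def endpoints_length)
  also have "\<dots> = ennreal ((M / 2) ^ k * (2 ^ k * (1 / M) ^ k))"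
  proof -
    have "(\<Sum>l<(2::nat) ^ k. ennreal ((1 / M) ^ k)) = ennreal (\<Sum>l<(2::nat) ^ k. (1 / M) ^ k)"
      using assms by (intro sum_ennreal) auto
    then show ?thesis
      using assms by (simp add: ennreal_mult)
  qed
  also have "(M / 2) ^ k * (2 ^ k * (1 / M) ^ k) = 1"
    using assms by (simp flip: power_mult_distrib)
  finally show "emeasure (density_measure M k) (space (density_measure M k)) = 1"
    by (simp add: density_measure_def)
qed

end

theory Submission
  imports Defs
begin

text \<open>Let \<open>V = W * \<rho>\<close> be the potential field. Since \<open>\<rho>\<close> is \<open>(M / 2) ^ k\<close> times Lebesgue measure
  on the union of the intervals \<open>[u, v]\<close> of generation \<open>k\<close>, the fundamental theorem of calculus
  gives, for every continuous \<open>W\<close>,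
  \<open>V' x = (M / 2) ^ k * (\<Sum>[u, v]. W (x - u) - W (x - v))\<close>
  (\<open>potential_field_density_measure\<close>). Thus \<open>V\<close> is differentiable although \<open>W\<close> has a kink at
  \<open>0\<close>, and it suffices to show that this finite sum vanishes when \<open>x\<close> lies in one of the
  intervals; the subdifferential is then \<open>{0}\<close>.

  Only increments of \<open>W\<close> between distances in the same range occur. If \<open>x\<close> lies in \<open>[u, v]\<close>, both
  distances are at most \<open>1 / M ^ k\<close>. Otherwise follow the ancestors of the two intervals down to the
  last common one, say of generation \<open>j\<close>: its length is \<open>1 / M ^ j\<close> and the gap between its
  two children is \<open>(M - 2) / M ^ Suc j\<close>, so both distances lie in the shell between these
  values. On each of these ranges \<open>W\<close> is, up to an additive constant, an explicit quadratic
  polynomial in the distance (\<open>affine_derivative_increment\<close>). Summed over all descendants of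
  a fixed interval, increments of a quadratic polynomial depend only on the center of that
  interval, because the descendants lie symmetrically in it
  (\<open>sum_quadratic_over_descendants\<close>).

  Now let \<open>J\<close> be the ancestor of generation \<open>j\<close> of the interval that contains \<open>x\<close>. With
  \<open>c = M / (2 * M - 4)\<close>, the part of \<open>V' x\<close> that comes from the descendants of \<open>J\<close> is
  \<open>- 2 / 2 ^ j * c * (M ^ j - 1) * (x - center of J)\<close>
  (\<open>sum_over_ancestor_descendants\<close>, by induction from \<open>j = k\<close> down to \<open>j = 0\<close>). For \<open>j = 0\<close> the
  interval \<open>J\<close> is \<open>[0, 1]\<close>, the sum is complete, and the factor \<open>M ^ 0 - 1\<close> is zero.\<close>

section \<open>Geometry of the iterated intervals\<close>

definition center :: "real \<Rightarrow> nat \<Rightarrow> nat \<Rightarrow> real" where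
  "center M j l = (fst (endpoints M j l) + snd (endpoints M j l)) / 2"

lemma fst_endpoints: "fst (endpoints M j l) = center M j l - 1 / (2 * M ^ j)"
  and snd_endpoints: "snd (endpoints M j l) = center M j l + 1 / (2 * M ^ j)"
  using endpoints_length[of M j l] by (simp_all add: center_def power_one_over field_simps)

lemma mem_interval_iff: "x \<in> interval M j l \<longleftrightarrow> \<bar>x - center M j l\<bar> \<le> 1 / (2 * M ^ j)"
  unfolding interval_def fst_endpoints snd_endpoints by auto

lemma center_left_child:
  "M > 0 \<Longrightarrow> center M (Suc j) (2 * l) = center M j l - (M - 1) / (2 * M ^ Suc j)"
proof -
  assume "M > 0"
  have "center M (Suc j) (2 * l) =
      fst (endpoints M j l) + (snd (endpoints M j l) - fst (endpoints M j l)) / M / 2"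
    using \<open>M > 0\<close> by (simp add: center_def[of M "Suc j"] left_part_def field_simps)
  also have "\<dots> = center M j l - (M - 1) / (2 * M ^ Suc j)"
    using \<open>M > 0\<close> unfolding fst_endpoints snd_endpoints by (simp add: field_simps)
  finally show ?thesis .
qed

lemma center_right_child:
  "M > 0 \<Longrightarrow> center M (Suc j) (2 * l + 1) = center M j l + (M - 1) / (2 * M ^ Suc j)"
proof -
  assume "M > 0"
  have "center M (Suc j) (2 * l + 1) =
      snd (endpoints M j l) - (snd (endpoints M j l) - fst (endpoints M j l)) / M / 2"
    using \<open>M > 0\<close> by (simp add: center_def[of M "Suc j"] right_part_def field_simps)
  also have "\<dots> = center M j l + (M - 1) / (2 * M ^ Suc j)"
    using \<open>M > 0\<close> unfolding fst_endpoints snd_endpoints by (simp add: field_simps)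
  finally show ?thesis .
qed

lemma interval_subset_parent:
  assumes "M \<ge> 1"
  shows "interval M (Suc j) n \<subseteq> interval M j (n div 2)"
proof -
  define E where "E = endpoints M j (n div 2)"
  have "0 \<le> snd E - fst E"
    using endpoints_length[of M j "n div 2"] assms by (simp add: E_def)
  then have "0 \<le> (snd E - fst E) / M" "(snd E - fst E) / M \<le> snd E - fst E"
    using assms by (auto simp: divide_le_eq mult_left_mono[of 1 M "snd E - fst E", simplified])
  then show ?thesis
    by (auto simp: interval_def left_part_def right_part_def E_def[symmetric])
qed

text \<open>Each bisection appends a binary digit to the index of an interval, so the ancestor \<open>m\<close>
  generations up is obtained by dropping \<open>m\<close> digits, and the descendants \<open>m\<close> generations
  down are the indices \<open>2 ^ m * l + r\<close> with \<open>r < 2 ^ m\<close>.\<close>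

lemma interval_subset_ancestor:
  assumes "M \<ge> 1"
  shows "interval M (j + m) n \<subseteq> interval M j (n div 2 ^ m)"
proof (induction m arbitrary: n)
  case (Suc m)
  have "interval M (j + Suc m) n \<subseteq> interval M (j + m) (n div 2)"
    using interval_subset_parent[OF assms, of "j + m" n] by simp
  also have "\<dots> \<subseteq> interval M j (n div 2 div 2 ^ m)" by (rule Suc)
  finally show ?case by (simp add: div_mult2_eq)
qed simp

lemma interval_descendant_subset:
  assumes "M \<ge> 1" "r < 2 ^ m"
  shows "interval M (j + m) (2 ^ m * l + r) \<subseteq> interval M j l"
  using interval_subset_ancestor[OF assms(1), of j m "2 ^ m * l + r"] assms(2) by simp

lemma endpoints_in_interval:
  assumes "M > 0"
  shows "fst (endpoints M j l) \<in> interval M j l" "snd (endpoints M j l) \<in> interval M j l"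
  using assms by (auto simp: mem_interval_iff fst_endpoints snd_endpoints)

lemma sum_descendants_split:
  fixes f :: "nat \<Rightarrow> real"
  shows "(\<Sum>r<2 ^ Suc m. f (2 ^ Suc m * l + r)) =
    (\<Sum>r<2 ^ m. f (2 ^ m * (2 * l) + r)) + (\<Sum>r<2 ^ m. f (2 ^ m * (2 * l + 1) + r))"
proof -
  have "(\<Sum>r<n + n'. h r) = (\<Sum>r<n. h r) + (\<Sum>r<n'. h (n + r))"
    for n n' :: nat and h :: "nat \<Rightarrow> real"
    by (induction n') (simp_all add: algebra_simps)
  from this[of "\<lambda>r. f (2 ^ Suc m * l + r)" "2 ^ m" "2 ^ m"] show ?thesis
    by (simp add: algebra_simps mult_2)
qed

text \<open>The centers of the two children are placed symmetrically about the center of the parent.\<close>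

lemma sum_center_descendants:
  assumes "M > 0"
  shows "(\<Sum>r<2 ^ m. center M (j + m) (2 ^ m * l + r)) = 2 ^ m * center M j l"
proof (induction m arbitrary: j l)
  case (Suc m)
  have "(\<Sum>r<2 ^ Suc m. center M (j + Suc m) (2 ^ Suc m * l + r)) =
      2 ^ m * (center M (Suc j) (2 * l) + center M (Suc j) (2 * l + 1))"
    using Suc[of "Suc j" "2 * l"] Suc[of "Suc j" "2 * l + 1"]
    unfolding sum_descendants_split by (simp add: distrib_left)
  also have "\<dots> = 2 ^ Suc m * center M j l"
    unfolding center_left_child[OF assms] center_right_child[OF assms] by simp
  finally show ?case .
qed simp

text \<open>The bounds are the width of the gap between two siblings and the length of their
  parent.\<close>

lemma sibling_distance:
  assumes "M > 3" "x \<in> interval M (Suc j) (2 * l)" "y \<in> interval M (Suc j) (2 * l + 1)"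
  shows "(M - 2) / M ^ Suc j \<le> y - x" "y - x \<le> 1 / M ^ j"
proof -
  define h where "h = 1 / (2 * M ^ Suc j)"
  have h: "(M - 2) / M ^ Suc j = 2 * (M - 2) * h" "1 / M ^ j = 2 * M * h"
      "(M - 1) / (2 * M ^ Suc j) = (M - 1) * h"
    using assms(1) by (auto simp: h_def field_simps)
  have "\<bar>x - center M j l + (M - 1) * h\<bar> \<le> h" "\<bar>y - center M j l - (M - 1) * h\<bar> \<le> h"
    using assms unfolding mem_interval_iff
    by (simp_all only: center_left_child center_right_child h h_def[symmetric])
  then show "(M - 2) / M ^ Suc j \<le> y - x" "y - x \<le> 1 / M ^ j"
    unfolding h by (auto simp: algebra_simps)
qed

section \<open>The potential on the relevant distance shells\<close>

text \<open>Continuity at the ends of the interval is enough, which makes this applicable on an interval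
  that starts at \<open>0\<close>, where \<open>W\<close> need not be differentiable.\<close>

lemma affine_derivative_increment:
  fixes W :: "real \<Rightarrow> real"
  assumes "continuous_on {u..v} W"
    and "\<And>z. u < z \<Longrightarrow> z < v \<Longrightarrow> (W has_real_derivative \<alpha> + \<beta> * z) (at z)"
    and "z \<in> {u..v}" "w \<in> {u..v}"
  shows "W z - W w = \<alpha> * (z - w) + \<beta> / 2 * (z\<^sup>2 - w\<^sup>2)"
proof -
  define F where "F z = W z - \<alpha> * z - \<beta> / 2 * z\<^sup>2" for z
  have "F z = F u" if "z \<in> {u..v}" for z
  proof (cases "u = v")
    case False
    with that have "u < v" by auto
    moreover have "continuous_on {u..v} F"
      unfolding F_def by (intro continuous_intros assms(1))
    moreover have "(F has_real_derivative 0) (at z)" if "u < z" "z < v" for z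
      unfolding F_def by (auto intro!: derivative_eq_intros assms(2)[OF that])
    ultimately show ?thesis
      using that by (intro DERIV_isconst2[of u v]) auto
  qed (use that in auto)
  from this[OF assms(3)] this[OF assms(4)] show ?thesis
    by (simp add: F_def algebra_simps)
qed

section \<open>Cancellation along the ancestors of an interval\<close>

text \<open>If \<open>W\<close> is quadratic on the differences \<open>x - y\<close> with \<open>y\<close> in the interval \<open>(j, l)\<close>, then
  each descendant contributes its length \<open>1 / M ^ (j + m)\<close> times an affine function of its
  center, and the centers average to that of the interval.\<close>

lemma sum_quadratic_over_descendants:
  fixes W :: "real \<Rightarrow> real"
  assumes M: "M \<ge> 1"
    and W: "\<And>y y'. y \<in> interval M j l \<Longrightarrow> y' \<in> interval M j l \<Longrightarrow>
           W (x - y) - W (x - y') = A * (y' - y) + B / 2 * ((x - y)\<^sup>2 - (x - y')\<^sup>2)"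
  shows "(\<Sum>r<2 ^ m. W (x - fst (endpoints M (j + m) (2 ^ m * l + r)))
                    - W (x - snd (endpoints M (j + m) (2 ^ m * l + r)))) =
    2 ^ m / M ^ (j + m) * (A + B * (x - center M j l))"
proof -
  have M0: "M > 0" using M by simp
  define C where "C r = center M (j + m) (2 ^ m * l + r)" for r
  have "W (x - fst (endpoints M (j + m) (2 ^ m * l + r)))
         - W (x - snd (endpoints M (j + m) (2 ^ m * l + r))) =
      1 / M ^ (j + m) * (A + B * x) - B / M ^ (j + m) * C r" if "r < 2 ^ m" for r
  proof -
    define h where "h = 1 / (2 * M ^ (j + m))"
    have h: "1 / M ^ (j + m) = 2 * h" "B / M ^ (j + m) = 2 * h * B" by (simp_all add: h_def)
    have "C r - h \<in> interval M j l" "C r + h \<in> interval M j l"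
      using endpoints_in_interval[OF M0, of "j + m" "2 ^ m * l + r"]
        interval_descendant_subset[OF M that, of j l]
      by (auto simp: subset_iff fst_endpoints snd_endpoints C_def h_def)
    from W[OF this] show ?thesis
      unfolding fst_endpoints snd_endpoints h C_def[symmetric] h_def[symmetric]
      by (simp add: power2_eq_square algebra_simps)
  qed
  then have "(\<Sum>r<2 ^ m. W (x - fst (endpoints M (j + m) (2 ^ m * l + r)))
         - W (x - snd (endpoints M (j + m) (2 ^ m * l + r)))) =
      (\<Sum>r<2 ^ m. 1 / M ^ (j + m) * (A + B * x) - B / M ^ (j + m) * C r)"
    by (intro sum.cong) auto
  also have "\<dots> = 2 ^ m * (1 / M ^ (j + m) * (A + B * x))
      - B / M ^ (j + m) * (2 ^ m * center M j l)"
    unfolding C_def sum_subtractf sum_distrib_left[symmetric] sum_center_descendants[OF M0]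
    by simp
  finally show ?thesis
    by (simp add: algebra_simps add_divide_distrib diff_divide_distrib)
qed

text \<open>The assumptions describe \<open>W\<close> on the core \<open>\<bar>z\<bar> \<le> 1 / M ^ k\<close> and on the shells that separate
  siblings. For \<open>m = k\<close> the right-hand side vanishes, because \<open>M ^ 0 - 1 = 0\<close>. The induction passes
  from an ancestor of \<open>x\<close> to its parent by adding the contribution of the sibling. That
  contribution is affine in \<open>x\<close>; the value of \<open>c\<close> and the coefficients \<open>M - 1 / 2\<close> and
  \<open>M ^ Suc j\<close> on the shells are what gives the sum of the two affine functions the same
  form with the center of the parent.\<close>

lemma sum_over_ancestor_descendants:
  fixes W :: "real \<Rightarrow> real"
  assumes M: "M > 3" and c: "c = M / (2 * M - 4)"
    and core: "\<And>z w. \<bar>z\<bar> \<le> 1 / M ^ k \<Longrightarrow> \<bar>w\<bar> \<le> 1 / M ^ k \<Longrightarrow>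
           W z - W w = c * (\<bar>w\<bar> - \<bar>z\<bar> + z\<^sup>2 - w\<^sup>2)"
    and shell: "\<And>j z w. j < k \<Longrightarrow> \<bar>z\<bar> \<in> {(M - 2) / M ^ Suc j .. 1 / M ^ j} \<Longrightarrow>
           \<bar>w\<bar> \<in> {(M - 2) / M ^ Suc j .. 1 / M ^ j} \<Longrightarrow>
           W z - W w = (M - 1 / 2 + c) * (\<bar>w\<bar> - \<bar>z\<bar>) + (2 * c + M ^ Suc j) / 2 * (z\<^sup>2 - w\<^sup>2)"
    and x: "x \<in> interval M k n"
    and "j + m = k"
  shows "(\<Sum>r<2 ^ m. W (x - fst (endpoints M k (2 ^ m * (n div 2 ^ m) + r)))
                    - W (x - snd (endpoints M k (2 ^ m * (n div 2 ^ m) + r)))) =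
    - (2 ^ m / M ^ k * (2 * c * (M ^ j - 1) * (x - center M j (n div 2 ^ m))))"
  using \<open>j + m = k\<close>
proof (induction m arbitrary: j)
  case 0
  have pos: "M ^ k > 0" using M by simp
  define h where "h = 1 / (2 * M ^ k)"
  define y where "y = x - center M k n"
  have y: "\<bar>y\<bar> \<le> h" using x by (simp add: mem_interval_iff y_def h_def)
  have h2: "1 / M ^ k = 2 * h" by (simp add: h_def)
  have "W (y + h) - W (y - h) = c * (\<bar>y - h\<bar> - \<bar>y + h\<bar> + (y + h)\<^sup>2 - (y - h)\<^sup>2)"
    using y by (intro core) (auto simp: h2)
  also have "\<dots> = c * (4 * h * y - 2 * y)"
    using y by (simp add: power2_eq_square algebra_simps)
  also have "\<dots> = - (1 / M ^ k * (2 * c * (M ^ k - 1) * y))"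
    using pos M by (simp add: h_def divide_simps) (simp add: algebra_simps)
  finally show ?case
    using 0 by (simp add: fst_endpoints snd_endpoints y_def h_def algebra_simps)
next
  case (Suc m)
  define q where "q = n div 2 ^ Suc m"
  define p where "p = n div 2 ^ m"
  define C where "C = center M j q"
  define P where "P = M ^ Suc j"
  define t where "t l = (\<Sum>r<2 ^ m. W (x - fst (endpoints M k (2 ^ m * l + r)))
      - W (x - snd (endpoints M k (2 ^ m * l + r))))" for l
  have jm: "Suc j + m = k" and jk: "j < k" using Suc.prems by auto
  have PM: "P > 0" "M ^ j = P / M" using M by (auto simp: P_def)
  have own: "t p = - (2 ^ m / M ^ k * (2 * c * (P - 1) * (x - center M (Suc j) p)))"
    using Suc.IH[OF jm] by (simp add: t_def P_def p_def)
  have xj: "x \<in> interval M (Suc j) p"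
    using x interval_subset_ancestor[of M "Suc j" m n] M jm by (auto simp: p_def)
  \<comment> \<open>The sign \<open>s\<close> treats both positions of \<open>x\<close> at once: \<open>s = 1\<close> if the sibling \<open>p'\<close> of the
    interval \<open>p\<close> containing \<open>x\<close> lies to the right of it, \<open>s = - 1\<close> if it lies to the left.\<close>
  have key: "t p + t p' = - (2 ^ Suc m / M ^ k * (2 * c * (M ^ j - 1) * (x - C)))"
    if s: "s\<^sup>2 = 1"
      and centers: "center M (Suc j) p = C - s * (M - 1) / (2 * P)"
        "center M (Suc j) p' = C + s * (M - 1) / (2 * P)"
      and dist: "\<And>y. y \<in> interval M (Suc j) p' \<Longrightarrow>
        s * (y - x) \<in> {(M - 2) / M ^ Suc j .. 1 / M ^ j}" for s p'
  proof -
    have sib: "t p' = 2 ^ m / M ^ (Suc j + m) *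
      (s * (M - 1 / 2 + c) + (2 * c + P) * (x - center M (Suc j) p'))"
      unfolding t_def jm[symmetric]
    proof (rule sum_quadratic_over_descendants)
      fix y y' assume "y \<in> interval M (Suc j) p'" "y' \<in> interval M (Suc j) p'"
      note d = this[THEN dist]
      have abs_eq: "\<bar>x - z\<bar> = s * (z - x)" if "s * (z - x) \<in> {(M - 2) / M ^ Suc j .. 1 / M ^ j}" for z
      proof -
        have "0 < (M - 2) / M ^ Suc j" using M by simp
        then have "s * (z - x) \<ge> 0" using that unfolding atLeastAtMost_iff by linarith
        with s show ?thesis by (auto simp: power2_eq_1_iff)
      qed
      show "W (x - y) - W (x - y') = s * (M - 1 / 2 + c) * (y' - y)
          + (2 * c + P) / 2 * ((x - y)\<^sup>2 - (x - y')\<^sup>2)"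
        using shell[OF jk, of "x - y" "x - y'", unfolded abs_eq[OF d(1)] abs_eq[OF d(2)], OF d]
        by (simp add: P_def mult.left_commute right_diff_distrib[symmetric])
    qed (use M in auto)
    \<comment> \<open>The part that does not contain \<open>x - C\<close> is \<open>s * (M / 2 - c * (M - 2))\<close>, which is zero by
    the choice of \<open>c\<close>.\<close>
    have "t p + t p' = 2 ^ m / M ^ k * (- (2 * c * (P - 1) * (x - (C - s * (M - 1) / (2 * P))))
        + (s * (M - 1 / 2 + c) + (2 * c + P) * (x - (C + s * (M - 1) / (2 * P)))))"
      unfolding own sib centers jm by (simp only: distrib_left mult_minus_right)
    also have "- (2 * c * (P - 1) * (x - (C - s * (M - 1) / (2 * P))))
        + (s * (M - 1 / 2 + c) + (2 * c + P) * (x - (C + s * (M - 1) / (2 * P))))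
      = - 2 * (2 * c * (P / M - 1) * (x - C))"
      using M PM by (simp add: c divide_simps) (simp add: algebra_simps)
    finally show ?thesis
      unfolding PM(2) by simp
  qed
  have "t (2 * q) + t (2 * q + 1) = - (2 ^ Suc m / M ^ k * (2 * c * (M ^ j - 1) * (x - C)))"
  proof -
    have M0: "M > 0" using M by simp
    note cl = center_left_child[OF M0, of j q, folded C_def P_def]
      and cr = center_right_child[OF M0, of j q, folded C_def P_def]
    have "p div 2 = q"
      by (simp add: p_def q_def div_mult2_eq[symmetric] mult.commute)
    then consider "p = 2 * q" | "p = 2 * q + 1" by (cases "even p") auto
    then show ?thesis
    proof cases
      case 1
      then show ?thesis
        using key[of 1 "2 * q + 1"] sibling_distance[OF M xj[unfolded 1]] cl cr by simp
    next
      case 2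
      then show ?thesis
        using key[of "- 1" "2 * q"] sibling_distance[OF M _ xj[unfolded 2]] cl cr
        by (simp add: add.commute diff_divide_distrib)
    qed
  qed
  moreover have "(\<Sum>r<2 ^ Suc m. W (x - fst (endpoints M k (2 ^ Suc m * q + r)))
      - W (x - snd (endpoints M k (2 ^ Suc m * q + r)))) = t (2 * q) + t (2 * q + 1)"
    unfolding t_def by (rule sum_descendants_split)
  ultimately show ?case
    by (simp only: q_def[symmetric] C_def)
qed

section \<open>Differentiating the potential field\<close>

text \<open>The integral of \<open>y \<mapsto> W (x - y)\<close> over an interval \<open>[u, v]\<close> equals \<open>F (x - u) - F (x - v)\<close> for an
  antiderivative \<open>F\<close> of \<open>W\<close>, and this expression can be differentiated in \<open>x\<close> without
  interchanging a derivative and an integral.\<close>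

lemma potential_field_density_measure:
  fixes W :: "real \<Rightarrow> real"
  assumes M: "M > 0" and W: "continuous_on UNIV W"
  shows "integrable (density_measure M k) (\<lambda>y. W (x - y))"
    and "(potential_field W (density_measure M k) has_real_derivative
      (M / 2) ^ k * (\<Sum>l<2 ^ k. W (x - fst (endpoints M k l)) - W (x - snd (endpoints M k l))))
      (at x)"
proof -
  have cont: "isCont W z" for z
    using W by (simp add: continuous_on_eq_continuous_at)
  have [measurable]: "W \<in> borel_measurable borel"
    using W by (rule borel_measurable_continuous_onI)
  have [measurable]: "interval M k l \<in> sets borel" for l
    by (simp add: interval_def)
  have [measurable]: "density_fun M k \<in> borel_measurable borel"
    unfolding density_fun_def by measurable
  have nonneg: "density_fun M k y \<ge> 0" for y
    using M by (simp add: density_fun_def sum_nonneg)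
  obtain F where F: "\<And>z. (F has_real_derivative W z) (at z)"
    using einterval_antiderivative[of "-\<infinity>" "\<infinity>" W] cont
    by (auto simp: has_real_derivative_iff_has_vector_derivative)
  have cell: "has_bochner_integral lborel (\<lambda>y. indicator (interval M k l) y *\<^sub>R W (x - y))
      (F (x - fst (endpoints M k l)) - F (x - snd (endpoints M k l)))" for x l
  proof -
    have "((\<lambda>y. - F (x - y)) has_real_derivative W (x - y)) (at y)" for y
      by (auto intro!: derivative_eq_intros DERIV_chain2[OF F])
    moreover have "continuous_on S (\<lambda>y. W (x - y))" for S
      by (intro continuous_on_compose2[OF W] continuous_intros) auto
    ultimately have "has_bochner_integral lborel (\<lambda>y. indicator (interval M k l) y *\<^sub>R W (x - y))
      ((- F (x - snd (endpoints M k l))) - (- F (x - fst (endpoints M k l))))"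
      unfolding interval_def
      using M by (intro has_bochner_integral_FTC_Icc)
        (auto simp: fst_endpoints snd_endpoints has_real_derivative_iff_has_vector_derivative[symmetric]
          intro: has_field_derivative_at_within)
    then show ?thesis by simp
  qed
  have H: "has_bochner_integral (density_measure M k) (\<lambda>y. W (x - y))
      ((M / 2) ^ k * (\<Sum>l<2 ^ k. F (x - fst (endpoints M k l)) - F (x - snd (endpoints M k l))))" for x
  proof -
    have "has_bochner_integral lborel
      (\<lambda>y. (M / 2) ^ k * (\<Sum>l<2 ^ k. indicator (interval M k l) y *\<^sub>R W (x - y)))
      ((M / 2) ^ k * (\<Sum>l<2 ^ k. F (x - fst (endpoints M k l)) - F (x - snd (endpoints M k l))))"
      by (intro has_bochner_integral_mult_right has_bochner_integral_sum cell)
    then have "has_bochner_integral lborel (\<lambda>y. density_fun M k y *\<^sub>R W (x - y))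
      ((M / 2) ^ k * (\<Sum>l<2 ^ k. F (x - fst (endpoints M k l)) - F (x - snd (endpoints M k l))))"
      by (simp add: density_fun_def sum_distrib_right mult.assoc)
    then show ?thesis
      unfolding density_measure_def
      by (intro has_bochner_integral_density) (auto simp: nonneg)
  qed
  then show "integrable (density_measure M k) (\<lambda>y. W (x - y))"
    by (blast intro: integrable.intros)
  have "potential_field W (density_measure M k) =
      (\<lambda>x. (M / 2) ^ k * (\<Sum>l<2 ^ k. F (x - fst (endpoints M k l)) - F (x - snd (endpoints M k l))))"
    unfolding potential_field_def using H by (auto intro: has_bochner_integral_integral_eq)
  then show "(potential_field W (density_measure M k) has_real_derivative
      (M / 2) ^ k * (\<Sum>l<2 ^ k. W (x - fst (endpoints M k l)) - W (x - snd (endpoints M k l))))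
      (at x)"
    by (auto intro!: derivative_eq_intros DERIV_chain2[OF F] sum.cong)
qed

section \<open>The steady state\<close>

theorem theorem9p2:
  fixes M :: real and k :: nat and a b :: "nat \<Rightarrow> real" and g W :: "real \<Rightarrow> real"
  assumes "M > 3"
    and "\<And>j. j \<in> {1..k} \<Longrightarrow> a j = - (M - 1 / 2)"
    and "\<And>j. j \<in> {1..k} \<Longrightarrow> b j = M ^ j"
    and "\<And>x. g (- x) = - g x"
    and "continuous_on UNIV g"
    and "\<And>r. g piecewise_C1_differentiable_on {-r..r}"
    and "\<And>x. \<bar>x\<bar> \<le> 1 / M ^ k \<Longrightarrow> g x = 0"
    and "\<And>j x. \<lbrakk>j \<in> {1..k}; (M - 2) / M ^ j \<le> \<bar>x\<bar>; \<bar>x\<bar> \<le> 1 / M ^ (j - 1)\<rbrakk>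
           \<Longrightarrow> g x = a j * sgn x + b j * x"
    and "\<And>x. W (- x) = W x"
    and "continuous_on UNIV W"
    and "\<And>x. x \<noteq> 0 \<Longrightarrow>
           (W has_real_derivative M / (2 * M - 4) * (- sgn x + 2 * x) + g x) (at x)"
  shows "steady_state W (density_measure M k)"
proof -
  note M = assms(1) and W_even = assms(9) and W_cont = assms(10) and W_deriv = assms(11)
  define c where "c = M / (2 * M - 4)"
  have W_abs: "W \<bar>z\<bar> = W z" for z
    using W_even[of z] by (simp add: abs_if)
  have W_cont_on: "continuous_on S W" for S
    using W_cont by (rule continuous_on_subset) simp
  have core: "W z - W w = c * (\<bar>w\<bar> - \<bar>z\<bar> + z\<^sup>2 - w\<^sup>2)"
    if "\<bar>z\<bar> \<le> 1 / M ^ k" "\<bar>w\<bar> \<le> 1 / M ^ k" for z w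
  proof -
    have "(W has_real_derivative - c + 2 * c * z) (at z)" if "0 < z" "z < 1 / M ^ k" for z
    proof -
      have "c * (- sgn z + 2 * z) + g z = - c + 2 * c * z"
        using assms(7)[of z] that by (simp add: algebra_simps)
      then show ?thesis using W_deriv[of z] that by (metis c_def less_irrefl)
    qed
    moreover have "\<bar>z\<bar> \<in> {0..1 / M ^ k}" "\<bar>w\<bar> \<in> {0..1 / M ^ k}"
      using that by auto
    ultimately show ?thesis
      using affine_derivative_increment[OF W_cont_on, of 0 "1 / M ^ k" "- c" "2 * c" "\<bar>z\<bar>" "\<bar>w\<bar>"]
      by (simp add: W_abs algebra_simps)
  qed
  have shell: "W z - W w = (M - 1 / 2 + c) * (\<bar>w\<bar> - \<bar>z\<bar>) + (2 * c + M ^ Suc j) / 2 * (z\<^sup>2 - w\<^sup>2)"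
    if j: "j < k" and zw: "\<bar>z\<bar> \<in> {(M - 2) / M ^ Suc j .. 1 / M ^ j}"
      "\<bar>w\<bar> \<in> {(M - 2) / M ^ Suc j .. 1 / M ^ j}" for j z w
  proof -
    have deriv: "(W has_real_derivative - (M - 1 / 2 + c) + (2 * c + M ^ Suc j) * y) (at y)"
      if "(M - 2) / M ^ Suc j < y" "y < 1 / M ^ j" for y
    proof -
      have "0 < (M - 2) / M ^ Suc j" using M by simp
      then have "y > 0" using that by linarith
      then have "g y = - (M - 1 / 2) + M ^ Suc j * y"
        using assms(8)[of "Suc j" y] assms(2,3)[of "Suc j"] j that by simp
      then have "c * (- sgn y + 2 * y) + g y = - (M - 1 / 2 + c) + (2 * c + M ^ Suc j) * y"
        using \<open>y > 0\<close> by (simp add: algebra_simps)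
      then show ?thesis using W_deriv[of y] \<open>y > 0\<close> by (metis c_def less_irrefl)
    qed
    show ?thesis
      using affine_derivative_increment[OF W_cont_on deriv zw]
      by (simp add: W_abs algebra_simps add_divide_distrib diff_divide_distrib)
  qed
  note pf = potential_field_density_measure[of M W, OF _ W_cont]
  have stationary: "0 \<in> subdifferential (potential_field W (density_measure M k)) x"
    if x: "density_fun M k x > 0" for x
  proof -
    obtain n where n: "n < 2 ^ k" "x \<in> interval M k n"
      using x unfolding density_fun_def
      by (metis (no_types, lifting) indicator_simps(2) lessThan_iff less_irrefl mult_zero_right sum.neutral)
    have "(\<Sum>l<2 ^ k. W (x - fst (endpoints M k l)) - W (x - snd (endpoints M k l))) = 0"
      using sum_over_ancestor_descendants[OF M c_def core shell n(2), of 0 k] n(1) by simp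
    then have "(potential_field W (density_measure M k) has_real_derivative 0) (at x)"
      using pf(2)[of k x] M by simp
    then show ?thesis
      by (simp add: subdifferential_differentiable)
  qed
  have [measurable]: "density_fun M k \<in> borel_measurable borel"
    unfolding density_fun_def interval_def by measurable
  have "AE x in density_measure M k. 0 \<in> subdifferential (potential_field W (density_measure M k)) x"
    unfolding density_measure_def
    by (subst AE_density) (auto simp: stationary[unfolded density_measure_def])
  then show ?thesis
    using pf(1)[of k] M by (simp add: steady_state_def)
qed

end
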